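(* Let $(X,d,\mu)$ be a space of homogeneous type, let $p\in(1,\infty)$, and let $T$ be a linear operator, bounded on $L^p(X)$, with kernel $K(x,y)$, i.e. $$Tf(x)=\int_XK(x,y)f(y)\,d\mu(y)$$ at least when $f$ is compactly supported and $x$ does not belong to the support of $f$. Let $M>1$ be such that the condition $d(x_0,y)\ge M\,d(x_0,x)$ implies the equivalence of $d(x_0,y)$ and $d(x,y)$ (if $d$ is a distance, one can take $M=2$), and assume that for some constant $C>0$ $$|K(x_0,y)-K(x,y)|\le C\,\frac{d(x_0,x)}{d(x_0,y)\,\mu(B(x,d(x,y)))}\qquad\text{if } d(x_0,y)\ge M\,d(x_0,x).$$ Let $q>1$ be an exponent such that, for some constant $C'>0$, $\mu(B(x,kr))\le C'k^q\mu(B(x,r))$ for every $k\ge1$, $r>0$, $x\in X$. Then there exists $c>0$ such that for every $f\in L^p(X)$, every $x_0\in X$, every ball $B_r(\overline{x})=B(\overline{x},r)$ containing $x_0$ (with $r>0$, $\overline{x}\in X$), and every $k\ge M$, $$\frac1{\mu(B_r(\overline{x}))}\int_{B_r(\overline{x})}\left|Tf-(Tf)_{B_r(\overline{x})}\right|d\mu\le c\left\{\frac1k\,\mathcal{M}f(x_0)+k^{q/p}\left(\frac1{\mu(B_{kr}(\overline{x}))}\int_{B_{kr}(\overline{x})}|f|^p\,d\mu\right)^{1/p}\right\}.$$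
   Context: A quasidistance on a set $X$ is a function $d:X\times X\to[0,\infty)$ such that, for some constant $C_d\ge1$: $d(x,y)=0$ iff $x=y$; $d(x,y)=d(y,x)$; $d(x,y)\le C_d(d(x,z)+d(z,y))$. Balls are $B(x,r)=B_r(x)=\{y\in X:d(x,y)<r\}$; they induce a topology. $(X,d,\mu)$ is a space of homogeneous type if $d$ is a quasidistance on $X$ whose balls are open in the topology they induce and $\mu$ is a positive Borel measure on $X$ for which there is $C_\mu\ge1$ with $0<\mu(B_{2r}(x))\le C_\mu\,\mu(B_r(x))<\infty$ for every $x\in X$, $r>0$. For a ball $B$, $g_B=\frac1{\mu(B)}\int_Bg\,d\mu$. The (uncentered) Hardy-Littlewood maximal function is $\mathcal{M}f(x)=\sup\frac1{\mu(B)}\int_B|f|\,d\mu$, the supremum being over all balls $B\ni x$. Two quantities are called equivalent if each is bounded by a constant (independent of the points involved) times the other.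
   Formalization: Adds that the measure of each ball is the supremum of the measures of its compact subsets (automatic if X is complete or locally compact); without it compactly supported functions can all vanish a.e. and the claim fails. The parenthesis that M=2 works for a distance is omitted. *)

theory Defs
  imports "HOL-Analysis.Analysis"
begin

text \<open>The underlying set \<open>X\<close> of a measure space \<open>\<mu>\<close> is \<open>space \<mu>\<close>; the values of \<open>d\<close> outside
  \<open>X \<times> X\<close> are irrelevant.\<close>

definition quasidistance_on :: "'a set \<Rightarrow> ('a \<Rightarrow> 'a \<Rightarrow> real) \<Rightarrow> bool" where
  "quasidistance_on X d \<longleftrightarrow>
     (\<forall>x\<in>X. \<forall>y\<in>X. 0 \<le> d x y \<and> (d x y = 0 \<longleftrightarrow> x = y) \<and> d x y = d y x) \<and>
     (\<exists>C\<ge>1. \<forall>x\<in>X. \<forall>y\<in>X. \<forall>z\<in>X. d x y \<le> C * (d x z + d z y))"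

definition qball :: "'a set \<Rightarrow> ('a \<Rightarrow> 'a \<Rightarrow> real) \<Rightarrow> 'a \<Rightarrow> real \<Rightarrow> 'a set" where
  "qball X d x r = {y\<in>X. d x y < r}"

definition qtopology :: "'a set \<Rightarrow> ('a \<Rightarrow> 'a \<Rightarrow> real) \<Rightarrow> 'a topology" where
  "qtopology X d = topology (\<lambda>U. U \<subseteq> X \<and> (\<forall>x\<in>U. \<exists>r>0. qball X d x r \<subseteq> U))"

lemma openin_qtopology:
  "openin (qtopology X d) U \<longleftrightarrow> U \<subseteq> X \<and> (\<forall>x\<in>U. \<exists>r>0. qball X d x r \<subseteq> U)"
proof -
  have "istopology (\<lambda>U. U \<subseteq> X \<and> (\<forall>x\<in>U. \<exists>r>0. qball X d x r \<subseteq> U))"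
    unfolding istopology_def
  proof (intro conjI allI impI ballI)
    fix S T x
    assume S: "S \<subseteq> X \<and> (\<forall>x\<in>S. \<exists>r>0. qball X d x r \<subseteq> S)"
      and T: "T \<subseteq> X \<and> (\<forall>x\<in>T. \<exists>r>0. qball X d x r \<subseteq> T)" and x: "x \<in> S \<inter> T"
    obtain r s where rs: "r > 0" "qball X d x r \<subseteq> S" "s > 0" "qball X d x s \<subseteq> T"
      using S T x by blast
    have "qball X d x (min r s) \<subseteq> S \<inter> T"
      using rs(2,4) by (auto simp: qball_def)
    then show "\<exists>r>0. qball X d x r \<subseteq> S \<inter> T"
      using rs(1,3) by (intro exI[of _ "min r s"]) auto
  next
    fix \<K> x
    assume *: "\<forall>K\<in>\<K>. K \<subseteq> X \<and> (\<forall>x\<in>K. \<exists>r>0. qball X d x r \<subseteq> K)" and "x \<in> \<Union>\<K>"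
    then obtain K where K: "K \<in> \<K>" "x \<in> K" by blast
    then obtain r where "r > 0" "qball X d x r \<subseteq> K" using * by meson
    with K show "\<exists>r>0. qball X d x r \<subseteq> \<Union>\<K>" by blast
  qed auto
  then show ?thesis
    by (simp add: qtopology_def topology_inverse')
qed

definition homogeneous_type :: "('a \<Rightarrow> 'a \<Rightarrow> real) \<Rightarrow> 'a measure \<Rightarrow> bool" where
  "homogeneous_type d \<mu> \<longleftrightarrow>
     quasidistance_on (space \<mu>) d \<and>
     (\<forall>x\<in>space \<mu>. \<forall>r>0. openin (qtopology (space \<mu>) d) (qball (space \<mu>) d x r)) \<and>
     sets \<mu> = sigma_sets (space \<mu>) {U. openin (qtopology (space \<mu>) d) U} \<and>
     (\<exists>C\<ge>1. \<forall>x\<in>space \<mu>. \<forall>r>0.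
        0 < emeasure \<mu> (qball (space \<mu>) d x (2 * r)) \<and>
        emeasure \<mu> (qball (space \<mu>) d x (2 * r))
          \<le> ennreal C * emeasure \<mu> (qball (space \<mu>) d x r) \<and>
        ennreal C * emeasure \<mu> (qball (space \<mu>) d x r) < \<infinity>)"

text \<open>Holds whenever \<open>\<mu>\<close> is a Radon measure, for instance if \<open>X\<close> is complete or locally compact.
  It guarantees that compactly supported functions are dense in \<open>L\<^sup>p\<close>; without it (for example
  on a Bernstein subset of \<open>[0,1]\<close> with outer Lebesgue measure) every compactly supported function
  may vanish almost everywhere, and having a kernel in the sense of \<open>has_kernel\<close> says nothing.\<close>

definition inner_regular_on_balls :: "('a \<Rightarrow> 'a \<Rightarrow> real) \<Rightarrow> 'a measure \<Rightarrow> bool" where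
  "inner_regular_on_balls d \<mu> \<longleftrightarrow>
     (\<forall>x\<in>space \<mu>. \<forall>r>0. emeasure \<mu> (qball (space \<mu>) d x r) =
        (SUP E\<in>{E. compactin (qtopology (space \<mu>) d) E \<and> E \<subseteq> qball (space \<mu>) d x r}.
           emeasure \<mu> E))"

text \<open>Elements of \<open>L\<^sup>p\<close> are represented by functions, and an operator on \<open>L\<^sup>p\<close> by a map on
  representatives that is linear up to null sets. Together with the norm bound this implies that
  functions equal almost everywhere have images equal almost everywhere. The scalars are those of
  an arbitrary complete separable real normed field, hence real or complex.\<close>

definition Lp :: "real \<Rightarrow> 'a measure \<Rightarrow>
    ('a \<Rightarrow> 'b::{real_normed_field, banach, second_countable_topology}) set" where
  "Lp p \<mu> = {f \<in> borel_measurable \<mu>. integrable \<mu> (\<lambda>x. norm (f x) powr p)}"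

definition Lp_norm :: "real \<Rightarrow> 'a measure \<Rightarrow>
    ('a \<Rightarrow> 'b::{real_normed_field, banach, second_countable_topology}) \<Rightarrow> real" where
  "Lp_norm p \<mu> f = (\<integral>x. norm (f x) powr p \<partial>\<mu>) powr (1 / p)"

definition bounded_linear_Lp :: "real \<Rightarrow> 'a measure \<Rightarrow>
    (('a \<Rightarrow> 'b::{real_normed_field, banach, second_countable_topology}) \<Rightarrow> 'a \<Rightarrow> 'b) \<Rightarrow> bool" where
  "bounded_linear_Lp p \<mu> T \<longleftrightarrow>
     (\<forall>f\<in>Lp p \<mu>. T f \<in> Lp p \<mu>) \<and>
     (\<forall>f\<in>Lp p \<mu>. \<forall>g\<in>Lp p \<mu>. \<forall>a b.
        AE x in \<mu>. T (\<lambda>y. a * f y + b * g y) x = a * T f x + b * T g x) \<and>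
     (\<exists>A. \<forall>f\<in>Lp p \<mu>. Lp_norm p \<mu> (T f) \<le> A * Lp_norm p \<mu> f)"

definition supp_on :: "'a topology \<Rightarrow> ('a \<Rightarrow> 'b::zero) \<Rightarrow> 'a set" where
  "supp_on \<tau> f = \<tau> closure_of {x \<in> topspace \<tau>. f x \<noteq> 0}"

text \<open>Since \<open>T f\<close> is only determined up to a null set, the representation is required for almost
  every \<open>x\<close> off the support. Integrability is explicit because the Bochner integral of a
  non-integrable function is \<open>0\<close> by convention.\<close>

definition has_kernel :: "real \<Rightarrow> ('a \<Rightarrow> 'a \<Rightarrow> real) \<Rightarrow> 'a measure \<Rightarrow>
    (('a \<Rightarrow> 'b::{real_normed_field, banach, second_countable_topology}) \<Rightarrow> 'a \<Rightarrow> 'b) \<Rightarrow>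
    ('a \<Rightarrow> 'a \<Rightarrow> 'b) \<Rightarrow> bool" where
  "has_kernel p d \<mu> T K \<longleftrightarrow>
     (\<forall>f\<in>Lp p \<mu>. compactin (qtopology (space \<mu>) d) (supp_on (qtopology (space \<mu>) d) f) \<longrightarrow>
        (AE x in \<mu>. x \<notin> supp_on (qtopology (space \<mu>) d) f \<longrightarrow>
           integrable \<mu> (\<lambda>y. K x y * f y) \<and> T f x = (\<integral>y. K x y * f y \<partial>\<mu>)))"

definition avg :: "'a measure \<Rightarrow> 'a set \<Rightarrow> ('a \<Rightarrow> 'b::{banach, second_countable_topology}) \<Rightarrow> 'b" where
  "avg \<mu> B g = (LINT x:B|\<mu>. g x) /\<^sub>R measure \<mu> B"

text \<open>Averages of nonnegative functions, with value \<open>\<infinity>\<close> if the integral diverges.\<close>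

definition nn_avg :: "'a measure \<Rightarrow> 'a set \<Rightarrow> ('a \<Rightarrow> real) \<Rightarrow> ennreal" where
  "nn_avg \<mu> B g = (\<integral>\<^sup>+x\<in>B. ennreal (g x) \<partial>\<mu>) / emeasure \<mu> B"

definition maximal_function :: "('a \<Rightarrow> 'a \<Rightarrow> real) \<Rightarrow> 'a measure \<Rightarrow>
    ('a \<Rightarrow> 'b::real_normed_vector) \<Rightarrow> 'a \<Rightarrow> ennreal" where
  "maximal_function d \<mu> f x =
     (SUP B\<in>{qball (space \<mu>) d y r | y r. y \<in> space \<mu> \<and> 0 < r \<and> x \<in> qball (space \<mu>) d y r}.
        nn_avg \<mu> B (\<lambda>z. norm (f z)))"

end

theory Submission
  imports Defs
begin

text \<open>Let \<open>B = B\<^sub>r(x\<^sub>b)\<close> and remove from \<open>f\<close> its restriction \<open>g\<close> to a large compact set disjoint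
  from \<open>B\<^sub>k\<^sub>r(x\<^sub>b)\<close>. The kernel represents \<open>T g\<close> almost everywhere on \<open>B\<close>, and the kernel regularity,
  summed over dyadic annuli around \<open>x\<^sub>b\<close>, shows that \<open>T g\<close> varies there by at most
  \<open>O(1/k) \<M> f(x\<^sub>0)\<close>. Since the kernel is only known almost everywhere, \<open>T g\<close> is compared with its
  value at a generic point of \<open>B\<close>; the center \<open>x\<^sub>b\<close> enters only through \<open>K(x\<^sub>b, y)\<close> in the
  triangle inequality. The remainder \<open>T (f - g)\<close> is controlled by the \<open>L\<^sup>p\<close> bound of \<open>T\<close>, and by
  inner regularity \<open>f - g\<close> is arbitrarily close in \<open>L\<^sup>p\<close> to the restriction of \<open>f\<close> to
  \<open>B\<^sub>k\<^sub>r(x\<^sub>b)\<close>.\<close>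

section \<open>Averages and local integrability of L^p functions\<close>

text \<open>The pointwise inequality t \<le> s + s^(1-p) t^p takes the place of Hoelder's
  inequality: integrated, each of its two terms contributes at most s times the measure of
  \<open>A\<close>, which is where the factor 2 comes from.\<close>

lemma nn_avg_le_of_powr_bound:
  fixes h :: "'a \<Rightarrow> 'b::{real_normed_vector, second_countable_topology}"
  assumes h: "h \<in> borel_measurable \<mu>" and A: "A \<in> sets \<mu>"
    and pos: "0 < emeasure \<mu> A" and fin: "emeasure \<mu> A < \<infinity>"
    and p: "1 < p" and s: "0 < s"
    and le: "(\<integral>\<^sup>+x. ennreal (norm (h x) powr p) \<partial>\<mu>) \<le> ennreal (s powr p) * emeasure \<mu> A"
  shows "nn_avg \<mu> A (\<lambda>x. norm (h x)) \<le> ennreal (2 * s)"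
proof -
  \<comment> \<open>For t \<le> s the first summand suffices; for t > s the second equals t
    (t/s)^(p-1), which is at least t because p > 1.\<close>
  have split: "t \<le> s + s powr (1 - p) * t powr p" if "0 \<le> t" for t
  proof (cases "t \<le> s")
    case False
    have "s powr (1 - p) * t powr p = t * (t / s) powr (p - 1)"
      using s False by (simp add: powr_divide powr_diff field_simps)
    moreover have "(t / s) powr (p - 1) \<ge> 1"
      using s False p by (intro ge_one_powr_ge_zero) auto
    ultimately show ?thesis
      using s False mult_left_mono[of 1 "(t / s) powr (p - 1)" t] by linarith
  qed (use s in \<open>simp add: add_increasing2\<close>)
  have "(\<integral>\<^sup>+x\<in>A. ennreal (norm (h x)) \<partial>\<mu>)
      \<le> (\<integral>\<^sup>+x. ennreal s * indicator A x + ennreal (s powr (1 - p)) * ennreal (norm (h x) powr p) \<partial>\<mu>)"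
    using s split
    by (intro nn_integral_mono)
       (auto simp: indicator_def ennreal_mult[symmetric] ennreal_plus[symmetric] simp del: ennreal_plus)
  also have "\<dots> = ennreal s * emeasure \<mu> A
      + ennreal (s powr (1 - p)) * (\<integral>\<^sup>+x. ennreal (norm (h x) powr p) \<partial>\<mu>)"
    using h A by (subst nn_integral_add) (auto simp: nn_integral_cmult nn_integral_cmult_indicator)
  also have "\<dots> \<le> ennreal s * emeasure \<mu> A
      + ennreal (s powr (1 - p)) * (ennreal (s powr p) * emeasure \<mu> A)"
    using le by (intro add_left_mono mult_left_mono) auto
  also have "\<dots> = ennreal (2 * s) * emeasure \<mu> A"
  proof -
    have "ennreal (s powr (1 - p)) * ennreal (s powr p) = ennreal s"
      using s by (simp add: ennreal_mult[symmetric] powr_add[symmetric])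
    moreover have "ennreal (2 * s) = ennreal s + ennreal s"
      using s by (simp add: ennreal_plus[symmetric] del: ennreal_plus)
    ultimately show ?thesis
      by (simp add: distrib_right mult.assoc[symmetric])
  qed
  finally show ?thesis
    unfolding nn_avg_def using pos fin
    by (simp add: divide_le_posI_ennreal mult.commute)
qed

text \<open>Since t \<le> 1 + t^p, an L^p function is integrable on every set of finite measure.
  Hence the mean of \<open>T f\<close> over a ball is a true integral and not the default value 0 of
  the Bochner integral.\<close>

lemma Lp_set_integrable:
  assumes h: "h \<in> Lp p \<mu>" and A: "A \<in> sets \<mu>" and fin: "emeasure \<mu> A < \<infinity>" and p: "1 < p"
  shows "set_integrable \<mu> A h"
  unfolding set_integrable_def
proof (rule Bochner_Integration.integrable_bound)
  show "integrable \<mu> (\<lambda>x. indicator A x + norm (h x) powr p)"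
    using h A fin by (intro Bochner_Integration.integrable_add) (auto simp: Lp_def)
  have "t \<le> 1 + t powr p" if "0 \<le> t" for t :: real
  proof (cases "t \<le> 1")
    case False
    then have "t powr 1 \<le> t powr p"
      using p by (intro powr_mono) auto
    then show ?thesis using False by simp
  qed (simp add: add_increasing2)
  then show "AE x in \<mu>. norm (indicator A x *\<^sub>R h x) \<le> norm (indicator A x + norm (h x) powr p)"
    by (auto simp: indicator_def)
  show "(\<lambda>x. indicator A x *\<^sub>R h x) \<in> borel_measurable \<mu>"
    using h A by (auto simp: Lp_def)
qed

lemma Lp_indicator:
  assumes "f \<in> Lp p \<mu>" "E \<in> sets \<mu>" "1 < p"
  shows "(\<lambda>y. indicator E y *\<^sub>R f y) \<in> Lp p \<mu>"
proof -
  have "integrable \<mu> (\<lambda>y. indicator E y *\<^sub>R norm (f y) powr p)"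
    using assms by (intro integrable_mult_indicator) (auto simp: Lp_def)
  moreover have "(\<lambda>y. indicator E y *\<^sub>R norm (f y) powr p) = (\<lambda>y. norm (indicator E y *\<^sub>R f y) powr p)"
    by (auto simp: indicator_def)
  ultimately show ?thesis
    using assms by (auto simp: Lp_def)
qed

text \<open>The mean of \<open>u\<close> differs from \<open>b\<close> by at most the mean deviation
  from \<open>b\<close>, so the triangle inequality costs only a factor 2. This frees the choice of
  the constant: later \<open>b\<close> is a value of the far part at a generic point.\<close>

lemma nn_avg_oscillation_le:
  fixes u :: "'a \<Rightarrow> 'b::{banach, second_countable_topology}"
  assumes u: "set_integrable \<mu> A u" and um: "u \<in> borel_measurable \<mu>" and A: "A \<in> sets \<mu>"
    and pos: "0 < emeasure \<mu> A" and fin: "emeasure \<mu> A < \<infinity>"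
  shows "nn_avg \<mu> A (\<lambda>x. norm (u x - avg \<mu> A u)) \<le> 2 * nn_avg \<mu> A (\<lambda>x. norm (u x - b))"
proof -
  let ?m = "measure \<mu> A" and ?I = "\<integral>\<^sup>+x\<in>A. ennreal (norm (u x - b)) \<partial>\<mu>"
  have em: "emeasure \<mu> A = ennreal ?m"
    using fin by (simp add: emeasure_eq_ennreal_measure)
  have m: "?m > 0"
    using pos em by simp
  have cb: "set_integrable \<mu> A (\<lambda>x. b)"
    using A fin by (simp add: set_integrable_def)
  have ub: "set_integrable \<mu> A (\<lambda>x. u x - b)"
    using u cb by (rule set_integral_diff)
  have "(LINT x:A|\<mu>. u x - b) = (LINT x:A|\<mu>. u x) - ?m *\<^sub>R b"
    using u cb A fin by (simp add: set_integral_diff) (simp add: set_lebesgue_integral_def)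
  then have "avg \<mu> A u - b = (LINT x:A|\<mu>. u x - b) /\<^sub>R ?m"
    using m by (simp add: avg_def scaleR_diff_right)
  then have "ennreal (norm (avg \<mu> A u - b)) * emeasure \<mu> A = ennreal (norm (LINT x:A|\<mu>. u x - b))"
    using m by (simp add: em ennreal_mult[symmetric])
  also have "\<dots> \<le> (\<integral>\<^sup>+x. ennreal (norm (indicator A x *\<^sub>R (u x - b))) \<partial>\<mu>)"
    unfolding set_lebesgue_integral_def
    using ub by (intro integral_norm_bound_ennreal) (simp add: set_integrable_def)
  also have "\<dots> = ?I"
    by (intro nn_integral_cong) (auto simp: indicator_def)
  finally have dev: "ennreal (norm (avg \<mu> A u - b)) * emeasure \<mu> A \<le> ?I" .
  have "(\<integral>\<^sup>+x\<in>A. ennreal (norm (u x - avg \<mu> A u)) \<partial>\<mu>)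
      \<le> (\<integral>\<^sup>+x. ennreal (norm (u x - b)) * indicator A x
            + ennreal (norm (avg \<mu> A u - b)) * indicator A x \<partial>\<mu>)"
  proof (intro nn_integral_mono)
    fix x
    have "norm (u x - avg \<mu> A u) \<le> norm (u x - b) + norm (avg \<mu> A u - b)"
      using norm_triangle_ineq4[of "u x - b" "avg \<mu> A u - b"] by simp
    then show "ennreal (norm (u x - avg \<mu> A u)) * indicator A x
      \<le> ennreal (norm (u x - b)) * indicator A x + ennreal (norm (avg \<mu> A u - b)) * indicator A x"
      by (auto simp: indicator_def ennreal_plus[symmetric] simp del: ennreal_plus)
  qed
  also have "\<dots> = ?I + ennreal (norm (avg \<mu> A u - b)) * emeasure \<mu> A"
    using um A by (subst nn_integral_add) (auto simp: nn_integral_cmult_indicator)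
  also have "\<dots> \<le> 2 * ?I"
    using dev by (simp add: mult_2 add_left_mono)
  finally show ?thesis
    unfolding nn_avg_def by (simp add: divide_right_mono_ennreal ennreal_times_divide)
qed

text \<open>The bound \<open>D\<close> is an extended number because it will be a multiple of the
  maximal function, which may be infinite.\<close>

lemma nn_avg_triangle:
  assumes h: "h \<in> borel_measurable \<mu>" and A: "A \<in> sets \<mu>"
    and pos: "0 < emeasure \<mu> A" and fin: "emeasure \<mu> A < \<infinity>"
    and le: "AE x in \<mu>. x \<in> A \<longrightarrow> ennreal (norm (u x)) \<le> D + ennreal (norm (h x))"
  shows "nn_avg \<mu> A (\<lambda>x. norm (u x)) \<le> D + nn_avg \<mu> A (\<lambda>x. norm (h x))"
proof -
  have "(\<integral>\<^sup>+x\<in>A. ennreal (norm (u x)) \<partial>\<mu>)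
      \<le> (\<integral>\<^sup>+x. D * indicator A x + ennreal (norm (h x)) * indicator A x \<partial>\<mu>)"
    using le by (intro nn_integral_mono_AE) (auto elim!: eventually_mono simp: indicator_def)
  also have "\<dots> = D * emeasure \<mu> A + (\<integral>\<^sup>+x\<in>A. ennreal (norm (h x)) \<partial>\<mu>)"
    using h A by (subst nn_integral_add) (auto simp: nn_integral_cmult_indicator)
  finally have "nn_avg \<mu> A (\<lambda>x. norm (u x))
      \<le> D * emeasure \<mu> A / emeasure \<mu> A + nn_avg \<mu> A (\<lambda>x. norm (h x))"
    unfolding nn_avg_def by (metis add_divide_distrib_ennreal divide_right_mono_ennreal)
  also have "D * emeasure \<mu> A / emeasure \<mu> A = D"
    using pos fin by (simp add: ennreal_mult_divide_eq)
  finally show ?thesis .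
qed

section \<open>Topology and measure of a space of homogeneous type\<close>

locale homogeneous_space =
  fixes d :: "'a \<Rightarrow> 'a \<Rightarrow> real" and \<mu> :: "'a measure"
  assumes homogeneous: "homogeneous_type d \<mu>"
begin

abbreviation "qb \<equiv> qball (space \<mu>) d"

abbreviation "\<tau> \<equiv> qtopology (space \<mu>) d"

lemma d_nonneg: "x \<in> space \<mu> \<Longrightarrow> y \<in> space \<mu> \<Longrightarrow> 0 \<le> d x y"
  and d_eq_0_iff: "x \<in> space \<mu> \<Longrightarrow> y \<in> space \<mu> \<Longrightarrow> d x y = 0 \<longleftrightarrow> x = y"
  and d_sym: "x \<in> space \<mu> \<Longrightarrow> y \<in> space \<mu> \<Longrightarrow> d x y = d y x"
  using homogeneous unfolding homogeneous_type_def quasidistance_on_def by blast+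

lemma quasi_triangle:
  obtains C where "C \<ge> 1"
    "\<And>x y z. x \<in> space \<mu> \<Longrightarrow> y \<in> space \<mu> \<Longrightarrow> z \<in> space \<mu> \<Longrightarrow> d x y \<le> C * (d x z + d z y)"
  using homogeneous unfolding homogeneous_type_def quasidistance_on_def by metis

lemma openin_qball: "x \<in> space \<mu> \<Longrightarrow> r > 0 \<Longrightarrow> openin \<tau> (qb x r)"
  using homogeneous unfolding homogeneous_type_def by blast

lemma topspace_qtopology: "topspace \<tau> = space \<mu>"
proof -
  have "qball (space \<mu>) d x 1 \<subseteq> space \<mu>" for x
    by (auto simp: qball_def)
  then have "openin \<tau> (space \<mu>)"
    unfolding openin_qtopology by (metis order_refl zero_less_one)
  moreover have "U \<subseteq> space \<mu>" if "openin \<tau> U" for U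
    using that unfolding openin_qtopology by blast
  ultimately show ?thesis
    by (meson openin_subset openin_topspace subset_antisym)
qed

lemma openin_sets: "openin \<tau> U \<Longrightarrow> U \<in> sets \<mu>"
  using homogeneous unfolding homogeneous_type_def by auto

lemma closedin_sets: "closedin \<tau> U \<Longrightarrow> U \<in> sets \<mu>"
  by (metis closedin_def double_diff openin_sets sets.compl_sets subset_refl topspace_qtopology)

lemma qball_sets: "x \<in> space \<mu> \<Longrightarrow> r > 0 \<Longrightarrow> qb x r \<in> sets \<mu>"
  by (simp add: openin_qball openin_sets)

lemma mem_qball: "y \<in> qb x r \<longleftrightarrow> y \<in> space \<mu> \<and> d x y < r"
  by (simp add: qball_def)

lemma qball_mono: "r \<le> s \<Longrightarrow> qb x r \<subseteq> qb x s"
  by (auto simp: qball_def)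

lemma emeasure_qball:
  assumes "x \<in> space \<mu>" "r > 0"
  shows "0 < emeasure \<mu> (qb x r)" "emeasure \<mu> (qb x r) < \<infinity>"
proof -
  obtain C where C: "C \<ge> 1" "0 < emeasure \<mu> (qb x (2 * r))"
      "emeasure \<mu> (qb x (2 * r)) \<le> ennreal C * emeasure \<mu> (qb x r)"
      "ennreal C * emeasure \<mu> (qb x r) < \<infinity>"
    using homogeneous assms unfolding homogeneous_type_def by blast
  \<comment> \<open>\<open>homogeneous_type\<close> asserts positivity at radius
    \<open>2 * r\<close>; the doubling inequality carries it down to radius
    \<open>r\<close>.\<close>
  show "0 < emeasure \<mu> (qb x r)"
    using C(2,3) by (metis gr_zeroI leD mult_zero_right)
  have "1 * emeasure \<mu> (qb x r) \<le> ennreal C * emeasure \<mu> (qb x r)"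
    using C(1) by (intro mult_right_mono) auto
  then show "emeasure \<mu> (qb x r) < \<infinity>"
    using C(4) by (simp add: order.strict_trans1)
qed

lemma emeasure_qball_eq: "x \<in> space \<mu> \<Longrightarrow> r > 0 \<Longrightarrow> emeasure \<mu> (qb x r) = ennreal (measure \<mu> (qb x r))"
  using emeasure_qball(2)[of x r] by (simp add: emeasure_eq_ennreal_measure)

lemma measure_qball_pos: "x \<in> space \<mu> \<Longrightarrow> r > 0 \<Longrightarrow> 0 < measure \<mu> (qb x r)"
  using emeasure_qball(1) emeasure_qball_eq by (metis ennreal_0 ennreal_less_zero_iff)

text \<open>Balls of radius d(x,y)/(2C) about distinct points are disjoint, since a common point
  would give d(x,y) < d(x,y). The Hausdorff property makes compact sets closed, hence measurable,
  and keeps the support of a function cut off to a compact set inside that set.\<close>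

lemma Hausdorff_qtopology: "Hausdorff_space \<tau>"
  unfolding Hausdorff_space_def topspace_qtopology
proof (intro allI impI)
  fix x y
  assume xy: "x \<in> space \<mu> \<and> y \<in> space \<mu> \<and> x \<noteq> y"
  obtain C where C: "C \<ge> 1"
      "\<And>x y z. x \<in> space \<mu> \<Longrightarrow> y \<in> space \<mu> \<Longrightarrow> z \<in> space \<mu> \<Longrightarrow> d x y \<le> C * (d x z + d z y)"
    using quasi_triangle by blast
  define r where "r = d x y / (2 * C)"
  have "d x y > 0"
    using xy d_nonneg d_eq_0_iff by (metis less_eq_real_def)
  then have r: "r > 0" "2 * (C * r) = d x y"
    using C(1) by (auto simp: r_def)
  have "disjnt (qb x r) (qb y r)"
  proof -
    have False if z: "z \<in> space \<mu>" "d x z < r" "d y z < r" for z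
    proof -
      have "d x y \<le> C * (d x z + d z y)"
        using C(2) xy z by blast
      also have "\<dots> < C * (r + r)"
        using C(1) z xy d_sym[of y z] by (intro mult_strict_left_mono) auto
      finally show False using r by (simp add: algebra_simps)
    qed
    then show ?thesis by (auto simp: disjnt_def mem_qball)
  qed
  moreover have "x \<in> qb x r" "y \<in> qb y r"
    using xy r d_eq_0_iff[of x x] d_eq_0_iff[of y y] by (auto simp: mem_qball)
  ultimately show "\<exists>U V. openin \<tau> U \<and> openin \<tau> V \<and> x \<in> U \<and> y \<in> V \<and> disjnt U V"
    using xy r openin_qball by meson
qed

lemma compactin_sets: "compactin \<tau> E \<Longrightarrow> E \<in> sets \<mu>"
  using Hausdorff_qtopology closedin_sets compactin_imp_closedin by blast

text \<open>Inner regularity fills each ball of integer radius about \<open>x\<close>, up to a null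
  set, by countably many compact sets. These balls cover the space, and finite unions of the compact
  sets form the exhaustion.\<close>

lemma compact_exhaustion:
  assumes reg: "inner_regular_on_balls d \<mu>" and x: "x \<in> space \<mu>"
  obtains G :: "nat \<Rightarrow> 'a set"
  where "incseq G" "\<And>n. compactin \<tau> (G n)" "AE y in \<mu>. \<exists>n. y \<in> G n"
proof -
  have "\<exists>E::nat \<Rightarrow> 'a set. (\<forall>j. compactin \<tau> (E j)) \<and> (AE y in \<mu>. y \<in> qb x r \<longrightarrow> (\<exists>j. y \<in> E j))"
    if r: "r > 0" for r
  proof -
    let ?A = "{E. compactin \<tau> E \<and> E \<subseteq> qb x r}"
    have "?A \<noteq> {}" by blast
    \<comment> \<open>The supremum over all compact subsets is already the supremum along a sequence
      of them.\<close>
    from ennreal_SUP_countable_SUP[OF this, of "emeasure \<mu>"]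
    obtain f :: "nat \<Rightarrow> ennreal" where f: "range f \<subseteq> emeasure \<mu> ` ?A"
        "(SUP E\<in>?A. emeasure \<mu> E) = (SUP i. f i)" by auto
    from f(1) have "\<forall>i. \<exists>E. E \<in> ?A \<and> f i = emeasure \<mu> E" by blast
    then obtain E where E: "\<And>i. E i \<in> ?A" "\<And>i. f i = emeasure \<mu> (E i)" by metis
    have sets: "(\<Union>i. E i) \<in> sets \<mu>"
      using E(1) compactin_sets by blast
    have sub: "(\<Union>i. E i) \<subseteq> qb x r"
      using E(1) by blast
    have "emeasure \<mu> (qb x r) = (SUP i. emeasure \<mu> (E i))"
      using reg x r f(2) E(2) unfolding inner_regular_on_balls_def by auto
    also have "\<dots> \<le> emeasure \<mu> (\<Union>i. E i)"
      using sets by (intro SUP_least emeasure_mono) auto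
    finally have "emeasure \<mu> (\<Union>i. E i) = emeasure \<mu> (qb x r)"
      using emeasure_mono[OF sub qball_sets[OF x r]] by (simp add: antisym)
    \<comment> \<open>Equality of measures gives a null difference because balls have finite
      measure.\<close>
    then have "emeasure \<mu> (qb x r - (\<Union>i. E i)) = 0"
      using sets sub qball_sets[OF x r] emeasure_qball(2)[OF x r]
      by (subst emeasure_Diff) (auto simp: less_top[symmetric])
    then have "qb x r - (\<Union>i. E i) \<in> null_sets \<mu>"
      using sets qball_sets[OF x r] by auto
    then have "AE y in \<mu>. y \<notin> qb x r - (\<Union>i. E i)"
      by (rule AE_not_in)
    then have "AE y in \<mu>. y \<in> qb x r \<longrightarrow> (\<exists>j. y \<in> E j)"
      by eventually_elim auto
    then show ?thesis using E(1) by blast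
  qed
  then have "\<forall>m. \<exists>E::nat \<Rightarrow> 'a set. (\<forall>j. compactin \<tau> (E j)) \<and>
      (AE y in \<mu>. y \<in> qb x (real (Suc m)) \<longrightarrow> (\<exists>j. y \<in> E j))"
    by simp
  from choice[OF this] obtain E :: "nat \<Rightarrow> nat \<Rightarrow> 'a set" where E: "\<And>m j. compactin \<tau> (E m j)"
      "\<And>m. AE y in \<mu>. y \<in> qb x (real (Suc m)) \<longrightarrow> (\<exists>j. y \<in> E m j)"
    by blast
  \<comment> \<open>Truncating both indices at \<open>n\<close> keeps the union finite, hence
    compact, and makes it increase with \<open>n\<close>.\<close>
  define G where "G n = (\<Union>m\<le>n. \<Union>j\<le>n. E m j)" for n
  show thesis
  proof
    show "incseq G"
      unfolding incseq_def G_def by fastforce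
    show "compactin \<tau> (G n)" for n
      unfolding G_def using E(1) by (auto intro!: compactin_Union)
    have "AE y in \<mu>. \<forall>m. y \<in> qb x (real (Suc m)) \<longrightarrow> (\<exists>j. y \<in> E m j)"
      using E(2) by (simp add: AE_all_countable)
    then show "AE y in \<mu>. \<exists>n. y \<in> G n"
      using AE_space
    proof eventually_elim
      case (elim y)
      obtain m :: nat where "d x y < real m"
        using reals_Archimedean2 by blast
      then have "y \<in> qb x (real (Suc m))"
        using elim by (simp add: mem_qball)
      then obtain j where "y \<in> E m j"
        using elim by blast
      then have "y \<in> G (max m j)"
        unfolding G_def by (intro UN_I[of m] UN_I[of j]) auto
      then show ?case ..
    qed
  qed
qed

section \<open>Maximal function bound for tails and regularity of the kernel\<close>

lemma maximal_function_ge: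
  assumes "y \<in> space \<mu>" "0 < r" "x \<in> qb y r"
  shows "(\<integral>\<^sup>+z\<in>qb y r. ennreal (norm (f z)) \<partial>\<mu>) \<le> maximal_function d \<mu> f x * emeasure \<mu> (qb y r)"
proof -
  have "nn_avg \<mu> (qb y r) (\<lambda>z. norm (f z)) \<le> maximal_function d \<mu> f x"
    unfolding maximal_function_def using assms by (intro SUP_upper) auto
  then have "nn_avg \<mu> (qb y r) (\<lambda>z. norm (f z)) * emeasure \<mu> (qb y r)
      \<le> maximal_function d \<mu> f x * emeasure \<mu> (qb y r)"
    by (rule mult_right_mono) simp
  then show ?thesis
    unfolding nn_avg_def ennreal_divide_times using emeasure_qball[OF assms(1,2)]
    by simp
qed

text \<open>On the annulus 2^j R \<le> d(xb,y) < 2^(j+1) R the ball of radius 2 d(xb,y) contains the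
  dyadic ball \<open>b j\<close>, so the weight is at most \<open>c j\<close>. Integrating over
  \<open>b j\<close> gives at most (W/R) 2^(-j) times the maximal function, and the geometric series
  sums to 2W/R. The doubled radius in the weight spares a doubling constant here.\<close>

lemma maximal_function_tail_bound:
  assumes xb: "xb \<in> space \<mu>" and R: "0 < R" and x0: "x0 \<in> qb xb R"
    and f: "f \<in> borel_measurable \<mu>" and W: "0 \<le> W"
  shows "(\<integral>\<^sup>+y\<in>space \<mu> - qb xb R.
        ennreal (W / (d xb y * measure \<mu> (qb xb (2 * d xb y))) * norm (f y)) \<partial>\<mu>)
    \<le> ennreal (2 * W / R) * maximal_function d \<mu> f x0"
proof -
  define b where "b j = qb xb (2 ^ Suc j * R)" for j
  define c where "c j = W / (2 ^ j * R * measure \<mu> (b j))" for j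
  have bpos: "0 < (2::real) ^ j * R" for j
    using R by simp
  have b: "b j \<in> sets \<mu>" "0 < measure \<mu> (b j)" "emeasure \<mu> (b j) = ennreal (measure \<mu> (b j))" for j
    unfolding b_def using qball_sets[OF xb bpos] measure_qball_pos[OF xb bpos] emeasure_qball_eq[OF xb bpos]
    by blast+
  have c: "0 \<le> c j" for j
    unfolding c_def using R W by simp
  have "(\<integral>\<^sup>+y\<in>space \<mu> - qb xb R. ennreal (W / (d xb y * measure \<mu> (qb xb (2 * d xb y))) * norm (f y)) \<partial>\<mu>)
      \<le> (\<integral>\<^sup>+y. (\<Sum>j. ennreal (c j) * (ennreal (norm (f y)) * indicator (b j) y)) \<partial>\<mu>)"
  proof (intro nn_integral_mono)
    fix y
    assume y: "y \<in> space \<mu>"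
    show "ennreal (W / (d xb y * measure \<mu> (qb xb (2 * d xb y))) * norm (f y)) * indicator (space \<mu> - qb xb R) y
      \<le> (\<Sum>j. ennreal (c j) * (ennreal (norm (f y)) * indicator (b j) y))"
    proof (cases "d xb y < R")
      case True
      then show ?thesis using y by (simp add: mem_qball)
    next
      case False
      define \<rho> where "\<rho> = d xb y"
      have "\<exists>n. \<rho> < 2 ^ n * R"
        using real_arch_pow[of 2 "\<rho> / R"] R by (auto simp: field_simps)
      \<comment> \<open>Minimality of \<open>n\<close> locates the annulus of \<open>y\<close>:
        \<open>n\<close> is not 0 because \<open>y\<close> lies outside the ball of radius
        \<open>R\<close>, and its predecessor \<open>j\<close> gives the lower bound on the
        distance.\<close>
      define n where "n = (LEAST n. \<rho> < 2 ^ n * R)"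
      have n: "\<rho> < 2 ^ n * R"
        unfolding n_def using \<open>\<exists>n. _\<close> by (rule LeastI_ex)
      then have "n \<noteq> 0"
        using False by (auto simp: \<rho>_def intro: ccontr)
      then obtain j where j: "n = Suc j"
        using not0_implies_Suc by blast
      have lower: "2 ^ j * R \<le> \<rho>"
        using not_less_Least[of j "\<lambda>n. \<rho> < 2 ^ n * R"] j unfolding n_def by force
      have "\<rho> > 0"
        using lower bpos[of j] by linarith
      have "b j \<subseteq> qb xb (2 * \<rho>)"
        unfolding b_def using lower by (intro qball_mono) simp
      then have "measure \<mu> (b j) \<le> measure \<mu> (qb xb (2 * \<rho>))"
        using emeasure_qball(2)[OF xb, of "2 * \<rho>"] qball_sets[OF xb, of "2 * \<rho>"] b(1) \<open>\<rho> > 0\<close>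
        by (intro measure_mono_fmeasurable) (auto simp: fmeasurable_def)
      then have "W / (\<rho> * measure \<mu> (qb xb (2 * \<rho>))) \<le> c j"
        unfolding c_def using lower b(2)[of j] bpos[of j] \<open>\<rho> > 0\<close> R W
        by (intro divide_left_mono mult_mono mult_pos_pos) auto
      then have "W / (\<rho> * measure \<mu> (qb xb (2 * \<rho>))) * norm (f y) \<le> c j * norm (f y)"
        by (intro mult_right_mono) auto
      then have "ennreal (W / (\<rho> * measure \<mu> (qb xb (2 * \<rho>))) * norm (f y))
          \<le> ennreal (c j) * (ennreal (norm (f y)) * indicator (b j) y)"
        using n j y c[of j] by (auto simp: b_def mem_qball \<rho>_def ennreal_mult[symmetric] intro!: ennreal_leI)
      also have "\<dots> = (\<Sum>i\<in>{j}. ennreal (c i) * (ennreal (norm (f y)) * indicator (b i) y))"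
        by simp
      also have "\<dots> \<le> (\<Sum>i. ennreal (c i) * (ennreal (norm (f y)) * indicator (b i) y))"
        by (intro sum_le_suminf) auto
      finally show ?thesis
        using False y by (simp add: mem_qball \<rho>_def)
    qed
  qed
  also have "\<dots> = (\<Sum>j. ennreal (c j) * (\<integral>\<^sup>+y\<in>b j. ennreal (norm (f y)) \<partial>\<mu>))"
    using f b(1) by (subst nn_integral_suminf) (auto simp: nn_integral_cmult)
  also have "\<dots> \<le> (\<Sum>j. ennreal ((W / R) * (1/2) ^ j) * maximal_function d \<mu> f x0)"
  proof (intro suminf_le)
    fix j
    \<comment> \<open>Every dyadic ball contains \<open>x0\<close>, so the uncentered maximal
      function at this one point controls all the averages.\<close>
    have "R \<le> 2 ^ Suc j * R"
      using R by (simp del: power_Suc)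
    then have "x0 \<in> b j"
      using x0 qball_mono unfolding b_def by blast
    then have "ennreal (c j) * (\<integral>\<^sup>+y\<in>b j. ennreal (norm (f y)) \<partial>\<mu>)
        \<le> ennreal (c j) * (maximal_function d \<mu> f x0 * emeasure \<mu> (b j))"
      using maximal_function_ge[OF xb bpos[of "Suc j"]] unfolding b_def by (intro mult_left_mono) auto
    also have "\<dots> = ennreal (c j * measure \<mu> (b j)) * maximal_function d \<mu> f x0"
      using c[of j] by (simp add: b(3) ennreal_mult ac_simps)
    also have "c j * measure \<mu> (b j) = (W / R) * (1/2) ^ j"
      using b(2)[of j] by (simp add: c_def power_divide)
    finally show "ennreal (c j) * (\<integral>\<^sup>+y\<in>b j. ennreal (norm (f y)) \<partial>\<mu>)
        \<le> ennreal ((W / R) * (1/2) ^ j) * maximal_function d \<mu> f x0" .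
  qed auto
  also have "\<dots> = (\<Sum>j. ennreal ((W / R) * (1/2) ^ j)) * maximal_function d \<mu> f x0"
    by (rule ennreal_suminf_multc)
  also have "(\<Sum>j. ennreal ((W / R) * (1/2) ^ j)) = ennreal (2 * W / R)"
  proof -
    have "(\<lambda>j. (W / R) * (1/2) ^ j) sums ((W / R) * (1 / (1 - 1/2)))"
      by (intro sums_mult geometric_sums) auto
    then show ?thesis
      using R W by (intro suminf_ennreal_eq) (auto simp: ac_simps)
  qed
  finally show ?thesis .
qed

text \<open>The assumed regularity involves a ball centered at the moving point \<open>x\<close>.
  Doubling and the equivalence of distances replace it by a ball centered at \<open>xb\<close>,
  giving a weight that is the same for all \<open>x\<close> in the ball and suits the tail
  bound.\<close>

lemma kernel_difference_bound:
  assumes M: "1 < M" and a: "0 < a" and C: "0 < C" and C': "0 < C'"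
    and equiv: "\<And>x0 x y. \<lbrakk>x0 \<in> space \<mu>; x \<in> space \<mu>; y \<in> space \<mu>; d x0 y \<ge> M * d x0 x\<rbrakk>
       \<Longrightarrow> d x0 y \<le> a * d x y"
    and reg: "\<And>x0 x y. \<lbrakk>x0 \<in> space \<mu>; x \<in> space \<mu>; y \<in> space \<mu>; d x0 y \<ge> M * d x0 x\<rbrakk>
       \<Longrightarrow> norm (K x0 y - K x y) \<le> C * (d x0 x / (d x0 y * measure \<mu> (qb x (d x y))))"
    and doubling: "\<And>k r x. \<lbrakk>1 \<le> k; 0 < r; x \<in> space \<mu>\<rbrakk>
       \<Longrightarrow> measure \<mu> (qb x (k * r)) \<le> C' * k powr q * measure \<mu> (qb x r)"
  obtains L where "0 < L"
    "\<And>xb x y r. \<lbrakk>xb \<in> space \<mu>; x \<in> qb xb r; y \<in> space \<mu>; M * r \<le> d xb y\<rbrakk>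
       \<Longrightarrow> norm (K xb y - K x y) \<le> L * r / (d xb y * measure \<mu> (qb xb (2 * d xb y)))"
proof -
  obtain Cd where Cd: "Cd \<ge> 1"
      "\<And>x y z. x \<in> space \<mu> \<Longrightarrow> y \<in> space \<mu> \<Longrightarrow> z \<in> space \<mu> \<Longrightarrow> d x y \<le> Cd * (d x z + d z y)"
    using quasi_triangle by blast
  \<comment> \<open>For z in the ball of radius 2\<rho> about \<open>xb\<close>, where \<rho> =
    d(xb,y), the quasi-triangle inequality gives d(x,z) < 3 Cd \<rho>, and \<rho> \<le> a d(x,y).
    Using \<open>max 1 a\<close> ensures H \<ge> 1, so that doubling applies to the dilation by
    \<open>H\<close>.\<close>
  define H where "H = 3 * Cd * max 1 a"
  have "1 * 1 \<le> (3 * Cd) * max 1 a"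
    using Cd(1) by (intro mult_mono) auto
  then have H: "1 \<le> H" by (simp add: H_def)
  define L where "L = C * (C' * H powr q)"
  have L: "0 < L"
    using C C' H by (simp add: L_def)
  moreover have "norm (K xb y - K x y) \<le> L * r / (d xb y * measure \<mu> (qb xb (2 * d xb y)))"
    if xb: "xb \<in> space \<mu>" and x': "x \<in> qb xb r" and y: "y \<in> space \<mu>" and far: "M * r \<le> d xb y"
    for xb x y r
  proof -
    have x: "x \<in> space \<mu>" "d xb x < r"
      using x' by (auto simp: mem_qball)
    then have r: "0 < r"
      using d_nonneg[OF xb x(1)] by simp
    define \<rho> where "\<rho> = d xb y"
    have r\<rho>: "r < \<rho>"
      using mult_strict_right_mono[OF M r] far by (simp add: \<rho>_def)
    have far': "M * d xb x \<le> d xb y"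
      using far x M mult_left_mono[of "d xb x" r M] by linarith
    have near: "\<rho> \<le> a * d x y"
      using equiv[OF xb x(1) y far'] by (simp add: \<rho>_def)
    \<comment> \<open>The ball about \<open>x\<close> in the regularity bound thus has positive
      radius and positive measure, so no division by zero is hidden there.\<close>
    then have "0 < a * d x y"
      using r r\<rho> by linarith
    then have dxy: "0 < d x y"
      using a by (simp add: zero_less_mult_iff)
    have "qb xb (2 * \<rho>) \<subseteq> qb x (H * d x y)"
    proof
      fix z assume "z \<in> qb xb (2 * \<rho>)"
      then have z: "z \<in> space \<mu>" "d xb z < 2 * \<rho>"
        by (auto simp: mem_qball)
      have "d x z \<le> Cd * (d x xb + d xb z)"
        using Cd(2) x z xb by blast
      also have "\<dots> < Cd * (3 * \<rho>)"
        using Cd(1) x z xb d_sym[of x xb] r\<rho> by (intro mult_strict_left_mono) auto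
      also have "\<dots> \<le> Cd * (3 * (max 1 a * d x y))"
        using Cd(1) order_trans[OF near mult_right_mono[of a "max 1 a" "d x y"]] dxy
        by (intro mult_left_mono) auto
      also have "\<dots> = H * d x y"
        by (simp add: H_def)
      finally show "z \<in> qb x (H * d x y)"
        using z by (simp add: mem_qball)
    qed
    moreover have "0 < H * d x y" "0 < 2 * \<rho>"
      using H dxy r r\<rho> by auto
    ultimately have "measure \<mu> (qb xb (2 * \<rho>)) \<le> measure \<mu> (qb x (H * d x y))"
      using emeasure_qball(2)[of x "H * d x y"] qball_sets x xb
      by (intro measure_mono_fmeasurable) (auto simp: fmeasurable_def)
    also have "\<dots> \<le> C' * H powr q * measure \<mu> (qb x (d x y))"
      using doubling H dxy x(1) by blast
    finally have vol: "measure \<mu> (qb xb (2 * \<rho>)) \<le> C' * H powr q * measure \<mu> (qb x (d x y))" .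
    have pos: "0 < measure \<mu> (qb xb (2 * \<rho>))" "0 < measure \<mu> (qb x (d x y))"
      using measure_qball_pos xb x dxy r r\<rho> by auto
    have "norm (K xb y - K x y) \<le> C * (d xb x / (\<rho> * measure \<mu> (qb x (d x y))))"
      using reg[OF xb x(1) y far'] by (simp add: \<rho>_def)
    also have "\<dots> \<le> C * (r / (\<rho> * measure \<mu> (qb x (d x y))))"
      using C x r r\<rho> pos by (intro mult_left_mono divide_right_mono) auto
    also have "\<dots> = L * r / (\<rho> * (C' * H powr q * measure \<mu> (qb x (d x y))))"
      using C' H by (simp add: L_def)
    also have "\<dots> \<le> L * r / (\<rho> * measure \<mu> (qb xb (2 * \<rho>)))"
      using vol L r r\<rho> pos C' H by (intro divide_left_mono mult_left_mono mult_pos_pos) auto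
    finally show ?thesis
      by (simp add: \<rho>_def)
  qed
  ultimately show thesis
    by (rule that)
qed

section \<open>Splitting off a compactly supported far part\<close>

text \<open>Cutting the ball out of an exhaustion by compact sets leaves sets \<open>E n\<close>;
  removing the restriction of \<open>f\<close> to \<open>E n\<close> leaves functions tending almost
  everywhere to the restriction of \<open>f\<close> to the ball. Dominated convergence with majorant
  |f|^p then brings the integral below \<open>s\<close>.\<close>

lemma compact_support_approximation:
  assumes reg: "inner_regular_on_balls d \<mu>" and x: "x \<in> space \<mu>" and R: "0 < R"
    and f: "f \<in> Lp p \<mu>" and p: "1 < p"
    and s: "(LINT y:qb x R|\<mu>. norm (f y) powr p) < s"
  obtains E where "compactin \<tau> E" "E \<inter> qb x R = {}"
    "(\<integral>y. norm (f y - indicator E y *\<^sub>R f y) powr p \<partial>\<mu>) < s"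
proof -
  obtain G :: "nat \<Rightarrow> 'a set" where G: "incseq G" "\<And>n. compactin \<tau> (G n)" "AE y in \<mu>. \<exists>n. y \<in> G n"
    using compact_exhaustion[OF reg x] by blast
  define E where "E n = G n - qb x R" for n
  have E: "compactin \<tau> (E n)" for n
  proof -
    \<comment> \<open>Balls are open, so removing one amounts to intersecting with a closed set,
      which preserves compactness.\<close>
    have "closedin \<tau> (topspace \<tau> - qb x R)"
      using openin_qball[OF x R] by blast
    then have "compactin \<tau> ((topspace \<tau> - qb x R) \<inter> G n)"
      using G(2) by (rule closed_Int_compactin)
    moreover have "(topspace \<tau> - qb x R) \<inter> G n = E n"
      using compactin_subset_topspace[OF G(2)[of n]] by (auto simp: E_def)
    ultimately show ?thesis by simp
  qed
  have f': "f \<in> borel_measurable \<mu>" "integrable \<mu> (\<lambda>x. norm (f x) powr p)"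
    using f by (auto simp: Lp_def)
  have "(\<lambda>n. \<integral>y. norm (f y - indicator (E n) y *\<^sub>R f y) powr p \<partial>\<mu>)
      \<longlonglongrightarrow> (LINT y:qb x R|\<mu>. norm (f y) powr p)"
    unfolding set_lebesgue_integral_def
  proof (rule integral_dominated_convergence[where w="\<lambda>y. norm (f y) powr p"])
    show "(\<lambda>y. indicator (qb x R) y *\<^sub>R norm (f y) powr p) \<in> borel_measurable \<mu>"
      using f' qball_sets[OF x R] by measurable
    show "(\<lambda>y. norm (f y - indicator (E n) y *\<^sub>R f y) powr p) \<in> borel_measurable \<mu>" for n
      using f' compactin_sets[OF E] by measurable
    show "AE y in \<mu>. (\<lambda>n. norm (f y - indicator (E n) y *\<^sub>R f y) powr p)
        \<longlonglongrightarrow> indicator (qb x R) y *\<^sub>R norm (f y) powr p"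
      using G(3)
    proof eventually_elim
      case (elim y)
      then obtain m where m: "y \<in> G m" by blast
      have "norm (f y - indicator (E n) y *\<^sub>R f y) powr p = indicator (qb x R) y *\<^sub>R norm (f y) powr p"
        if "m \<le> n" for n
      proof -
        have "y \<in> G n"
          using m that G(1) by (auto simp: incseq_def)
        then show ?thesis by (auto simp: E_def indicator_def)
      qed
      then show ?case
        by (intro tendsto_eventually) (auto simp: eventually_sequentially)
    qed
    show "AE y in \<mu>. norm (norm (f y - indicator (E n) y *\<^sub>R f y) powr p) \<le> norm (f y) powr p" for n
      by (auto simp: indicator_def)
  qed (rule f')
  then have "eventually (\<lambda>n. (\<integral>y. norm (f y - indicator (E n) y *\<^sub>R f y) powr p \<partial>\<mu>) < s) sequentially"
    using s by (rule order_tendstoD)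
  then obtain n where "(\<integral>y. norm (f y - indicator (E n) y *\<^sub>R f y) powr p \<partial>\<mu>) < s"
    by (auto simp: eventually_sequentially)
  then show thesis
    using that[of "E n"] E by (auto simp: E_def)
qed

text \<open>\<open>E\<close> is closed in the Hausdorff topology, so taking the closure does not
  leave it. This makes the cut-off function admissible in \<open>has_kernel\<close>.\<close>

lemma supp_on_subset_compact:
  fixes f :: "'a \<Rightarrow> 'c::real_vector"
  assumes "compactin \<tau> E"
  shows "supp_on \<tau> (\<lambda>y. indicator E y *\<^sub>R f y) \<subseteq> E"
    and "compactin \<tau> (supp_on \<tau> (\<lambda>y. indicator E y *\<^sub>R f y))"
proof -
  show sub: "supp_on \<tau> (\<lambda>y. indicator E y *\<^sub>R f y) \<subseteq> E"
    unfolding supp_on_def using assms Hausdorff_qtopology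
    by (intro closure_of_minimal compactin_imp_closedin) (auto simp: indicator_def)
  show "compactin \<tau> (supp_on \<tau> (\<lambda>y. indicator E y *\<^sub>R f y))"
    using assms sub by (rule closed_compactin) (simp add: supp_on_def)
qed

text \<open>The constant \<open>b\<close> is the value of the far part at a point of the ball where
  the kernel formula holds. The factor 4 is 2 from comparing two points through \<open>xb\<close>
  times 2 from the geometric series; 1/k is the ratio of the radii r and kr.\<close>

lemma far_part_oscillation:
  fixes T :: "('a \<Rightarrow> 'b::{real_normed_field, banach, second_countable_topology}) \<Rightarrow> 'a \<Rightarrow> 'b"
  assumes ker: "has_kernel p d \<mu> T K" and p: "1 < p" and f: "f \<in> Lp p \<mu>"
    and xb: "xb \<in> space \<mu>" and r: "0 < r" and M: "1 < M" "M \<le> k" and x0: "x0 \<in> qb xb r"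
    and E: "compactin \<tau> E" "E \<inter> qb xb (k * r) = {}"
    and L: "0 < L" "\<And>x y. \<lbrakk>x \<in> qb xb r; y \<in> space \<mu>; M * r \<le> d xb y\<rbrakk>
       \<Longrightarrow> norm (K xb y - K x y) \<le> L * r / (d xb y * measure \<mu> (qb xb (2 * d xb y)))"
  obtains b where "AE x in \<mu>. x \<in> qb xb r \<longrightarrow>
    ennreal (norm (T (\<lambda>y. indicator E y *\<^sub>R f y) x - b)) \<le> ennreal (4 * L / k) * maximal_function d \<mu> f x0"
proof -
  let ?g = "\<lambda>y. indicator E y *\<^sub>R f y"
  define V where "V y = d xb y * measure \<mu> (qb xb (2 * d xb y))" for y
  have Mr: "M * r \<le> k * r" "r \<le> k * r"
    using M r by simp_all
  have off: "x \<notin> supp_on \<tau> ?g" if "x \<in> qb xb r" for x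
    using supp_on_subset_compact(1)[OF E(1), of f] E(2) that qball_mono[OF Mr(2)] by blast
  define P where "P x \<longleftrightarrow> integrable \<mu> (\<lambda>y. K x y * ?g y) \<and> T ?g x = (\<integral>y. K x y * ?g y \<partial>\<mu>)" for x
  have "AE x in \<mu>. x \<notin> supp_on \<tau> ?g \<longrightarrow> P x"
    using ker Lp_indicator[OF f compactin_sets[OF E(1)] p] supp_on_subset_compact(2)[OF E(1)]
    unfolding has_kernel_def P_def by blast
  then have good: "AE x in \<mu>. x \<in> qb xb r \<longrightarrow> P x"
    using off by (auto elim!: eventually_mono)
  \<comment> \<open>A property valid almost everywhere on a ball holds at some point of it, since
    the ball has positive measure.\<close>
  have "\<exists>x'\<in>qb xb r. P x'"
  proof (rule ccontr)
    assume "\<not> (\<exists>x'\<in>qb xb r. P x')"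
    then have "AE x in \<mu>. x \<notin> qb xb r"
      using good by (auto elim!: eventually_mono)
    then have "emeasure \<mu> (qb xb r) = 0"
      using qball_sets[OF xb r] by (simp add: AE_iff_null_sets[symmetric] null_setsD1)
    then show False
      using emeasure_qball(1)[OF xb r] by simp
  qed
  then obtain x' where x': "x' \<in> qb xb r" "P x'" by blast
  have "ennreal (norm (T ?g x - T ?g x')) \<le> ennreal (4 * L / k) * maximal_function d \<mu> f x0"
    if x: "x \<in> qb xb r" "P x" for x
  proof -
    have "T ?g x - T ?g x' = (\<integral>y. K x y * ?g y - K x' y * ?g y \<partial>\<mu>)"
      using x x' by (simp add: P_def)
    then have "ennreal (norm (T ?g x - T ?g x')) \<le> (\<integral>\<^sup>+y. ennreal (norm (K x y * ?g y - K x' y * ?g y)) \<partial>\<mu>)"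
      using x x' by (simp add: P_def integral_norm_bound_ennreal del: Bochner_Integration.integral_diff)
    also have "\<dots> \<le> (\<integral>\<^sup>+y\<in>space \<mu> - qb xb (k * r). ennreal (2 * (L * r) / V y * norm (f y)) \<partial>\<mu>)"
    proof (intro nn_integral_mono)
      fix y assume y: "y \<in> space \<mu>"
      show "ennreal (norm (K x y * ?g y - K x' y * ?g y))
        \<le> ennreal (2 * (L * r) / V y * norm (f y)) * indicator (space \<mu> - qb xb (k * r)) y"
      proof (cases "y \<in> E")
        case True
        then have far: "y \<notin> qb xb (k * r)"
          using E(2) by blast
        then have "M * r \<le> d xb y"
          using Mr y by (auto simp: mem_qball)
        then have "norm (K xb y - K x y) \<le> L * r / V y" "norm (K xb y - K x' y) \<le> L * r / V y"
          using L(2) x x' y by (auto simp: V_def)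
        then have "norm (K x y - K x' y) \<le> 2 * (L * r) / V y"
          \<comment> \<open>Only the kernel is evaluated at the center \<open>xb\<close>; the
            formula for the operator is used at \<open>x\<close> and \<open>x'\<close>
            alone.\<close>
          using norm_triangle_ineq4[of "K xb y - K x' y" "K xb y - K x y"] by simp
        then have "norm (K x y - K x' y) * norm (f y) \<le> 2 * (L * r) / V y * norm (f y)"
          by (intro mult_right_mono) auto
        then show ?thesis
          using True far y by (simp add: norm_mult[symmetric] left_diff_distrib ennreal_leI)
      qed simp
    qed
    \<comment> \<open>The tail bound is applied with W = 2Lr and R = kr.\<close>
    also have "\<dots> \<le> ennreal (2 * (2 * (L * r)) / (k * r)) * maximal_function d \<mu> f x0"
      unfolding V_def using r M L(1) f x0 qball_mono[OF Mr(2)]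
      by (intro maximal_function_tail_bound[OF xb]) (auto simp: Lp_def)
    also have "2 * (2 * (L * r)) / (k * r) = 4 * L / k"
      using r by simp
    finally show ?thesis .
  qed
  then have "AE x in \<mu>. x \<in> qb xb r \<longrightarrow>
      ennreal (norm (T ?g x - T ?g x')) \<le> ennreal (4 * L / k) * maximal_function d \<mu> f x0"
    using good by (auto elim!: eventually_mono)
  then show thesis
    by (rule that)
qed

end

section \<open>Combination of the far and near estimates\<close>

theorem theorem3p10:
  fixes d :: "'a \<Rightarrow> 'a \<Rightarrow> real"
    and \<mu> :: "'a measure"
    and T :: "('a \<Rightarrow> 'b::{real_normed_field, banach, second_countable_topology}) \<Rightarrow> 'a \<Rightarrow> 'b"
    and K :: "'a \<Rightarrow> 'a \<Rightarrow> 'b"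
    and p q M :: real
  assumes "homogeneous_type d \<mu>"
    and "inner_regular_on_balls d \<mu>"
    and "1 < p"
    and "bounded_linear_Lp p \<mu> T"
    and "has_kernel p d \<mu> T K"
    and "1 < M"
    and "\<exists>a>0. \<forall>x0\<in>space \<mu>. \<forall>x\<in>space \<mu>. \<forall>y\<in>space \<mu>. d x0 y \<ge> M * d x0 x \<longrightarrow>
           d x0 y \<le> a * d x y \<and> d x y \<le> a * d x0 y"
    and "\<exists>C>0. \<forall>x0\<in>space \<mu>. \<forall>x\<in>space \<mu>. \<forall>y\<in>space \<mu>. d x0 y \<ge> M * d x0 x \<longrightarrow>
           norm (K x0 y - K x y)
             \<le> C * (d x0 x / (d x0 y * measure \<mu> (qball (space \<mu>) d x (d x y))))"
    and "1 < q"
    and "\<exists>C'>0. \<forall>k\<ge>1. \<forall>r>0. \<forall>x\<in>space \<mu>.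
           measure \<mu> (qball (space \<mu>) d x (k * r))
             \<le> C' * k powr q * measure \<mu> (qball (space \<mu>) d x r)"
  shows "\<exists>c>0. \<forall>f\<in>Lp p \<mu>. \<forall>x0\<in>space \<mu>. \<forall>xbar\<in>space \<mu>. \<forall>r>0. \<forall>k\<ge>M.
           x0 \<in> qball (space \<mu>) d xbar r \<longrightarrow>
           nn_avg \<mu> (qball (space \<mu>) d xbar r)
               (\<lambda>x. norm (T f x - avg \<mu> (qball (space \<mu>) d xbar r) (T f)))
             \<le> ennreal c *
                (ennreal (1 / k) * maximal_function d \<mu> f x0 +
                 ennreal (k powr (q / p) *
                   avg \<mu> (qball (space \<mu>) d xbar (k * r)) (\<lambda>x. norm (f x) powr p) powr (1 / p)))"
proof -
  interpret homogeneous_space d \<mu>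
    by unfold_locales fact
  obtain a where a: "a > 0"
      "\<And>x0 x y. \<lbrakk>x0 \<in> space \<mu>; x \<in> space \<mu>; y \<in> space \<mu>; d x0 y \<ge> M * d x0 x\<rbrakk> \<Longrightarrow> d x0 y \<le> a * d x y"
    using assms(7) by blast
  obtain C where C: "C > 0"
      "\<And>x0 x y. \<lbrakk>x0 \<in> space \<mu>; x \<in> space \<mu>; y \<in> space \<mu>; d x0 y \<ge> M * d x0 x\<rbrakk>
        \<Longrightarrow> norm (K x0 y - K x y) \<le> C * (d x0 x / (d x0 y * measure \<mu> (qb x (d x y))))"
    using assms(8) by blast
  obtain C' where C': "C' > 0"
      "\<And>k r x. \<lbrakk>1 \<le> k; 0 < r; x \<in> space \<mu>\<rbrakk>
        \<Longrightarrow> measure \<mu> (qb x (k * r)) \<le> C' * k powr q * measure \<mu> (qb x r)"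
    using assms(10) by blast
  obtain L where L: "0 < L"
      "\<And>xb x y r. \<lbrakk>xb \<in> space \<mu>; x \<in> qb xb r; y \<in> space \<mu>; M * r \<le> d xb y\<rbrakk>
        \<Longrightarrow> norm (K xb y - K x y) \<le> L * r / (d xb y * measure \<mu> (qb xb (2 * d xb y)))"
    using kernel_difference_bound[OF assms(6) a(1) C(1) C'(1) a(2) C(2) C'(2)] by blast
  \<comment> \<open>The operator bound is raised to at least 1, so that one can divide by it
    below.\<close>
  obtain A where A: "1 \<le> A" "\<And>h. h \<in> Lp p \<mu> \<Longrightarrow> Lp_norm p \<mu> (T h) \<le> A * Lp_norm p \<mu> h"
  proof -
    obtain A0 where A0: "\<And>h. h \<in> Lp p \<mu> \<Longrightarrow> Lp_norm p \<mu> (T h) \<le> A0 * Lp_norm p \<mu> h"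
      using assms(4) unfolding bounded_linear_Lp_def by blast
    have "Lp_norm p \<mu> (T h) \<le> max 1 A0 * Lp_norm p \<mu> h" if "h \<in> Lp p \<mu>" for h
      using A0[OF that] mult_right_mono[of A0 "max 1 A0" "Lp_norm p \<mu> h"] by (simp add: Lp_norm_def)
    then show thesis
      using that[of "max 1 A0"] by simp
  qed
  note TLp = assms(4)[unfolded bounded_linear_Lp_def, THEN conjunct1, rule_format]
  have bound: "(\<integral>\<^sup>+x. ennreal (norm (T h x) powr p) \<partial>\<mu>) \<le> ennreal ((A * w) powr p)"
    if h: "h \<in> Lp p \<mu>" and w: "0 < w" "(\<integral>x. norm (h x) powr p \<partial>\<mu>) < w powr p" for h w
  proof -
    let ?I = "\<integral>x. norm (T h x) powr p \<partial>\<mu>"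
    have "Lp_norm p \<mu> h \<le> (w powr p) powr (1 / p)"
      unfolding Lp_norm_def using w assms(3) by (intro powr_mono2) auto
    then have "A * Lp_norm p \<mu> h \<le> A * w"
      using w assms(3) A(1) by (simp add: powr_powr)
    then have "?I powr (1 / p) \<le> A * w"
      using A(2)[OF h] by (simp add: Lp_norm_def)
    then have "(?I powr (1 / p)) powr p \<le> (A * w) powr p"
      using assms(3) by (intro powr_mono2) auto
    then have "?I \<le> (A * w) powr p"
      using assms(3) by (simp add: powr_powr)
    moreover have "(\<integral>\<^sup>+x. ennreal (norm (T h x) powr p) \<partial>\<mu>) = ennreal ?I"
      using TLp[OF h] by (intro nn_integral_eq_integral) (auto simp: Lp_def)
    ultimately show ?thesis
      by (simp add: ennreal_leI)
  qed
  \<comment> \<open>Replacing the mean by \<open>b\<close> doubles everything: 4L becomes 8L, and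
    the factor 2 from \<open>nn_avg_le_of_powr_bound\<close> becomes 4.\<close>
  define c where "c = 8 * L + 4 * A * C' powr (1 / p)"
  have c: "0 < c"
    using L(1) A(1) by (simp add: c_def add_pos_nonneg)
  show ?thesis
  proof (intro exI[of _ c] conjI c ballI allI impI)
    fix f :: "'a \<Rightarrow> 'b" and x0 xb r k
    assume f: "f \<in> Lp p \<mu>" and "x0 \<in> space \<mu>" and xb: "xb \<in> space \<mu>" and r: "0 < r" and k: "M \<le> k"
      and x0: "x0 \<in> qb xb r"
    let ?B = "qb xb r" and ?F = "maximal_function d \<mu> f x0"
    let ?osc = "nn_avg \<mu> ?B (\<lambda>x. norm (T f x - avg \<mu> ?B (T f)))"
    define v where "v = avg \<mu> (qb xb (k * r)) (\<lambda>x. norm (f x) powr p)"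
    define N where "N = k powr (q / p) * v powr (1 / p)"
    note B = qball_sets[OF xb r] emeasure_qball[OF xb r]
    have kr: "1 < k" "0 < k * r"
      using k assms(6) r by auto
    have mB: "0 < measure \<mu> ?B" "0 < measure \<mu> (qb xb (k * r))"
      using measure_qball_pos[OF xb] r kr by auto
    have v: "0 \<le> v" "(LINT y:qb xb (k * r)|\<mu>. norm (f y) powr p) = v * measure \<mu> (qb xb (k * r))"
    proof -
      have "0 \<le> (LINT y:qb xb (k * r)|\<mu>. norm (f y) powr p)"
        unfolding set_lebesgue_integral_def by (intro integral_nonneg_AE) auto
      then show "0 \<le> v"
        unfolding v_def avg_def by simp
      show "(LINT y:qb xb (k * r)|\<mu>. norm (f y) powr p) = v * measure \<mu> (qb xb (k * r))"
        using mB(2) by (simp add: v_def avg_def)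
    qed
    \<comment> \<open>By doubling, the integral of |f|^p over the ball of radius kr is at most C'
      k^q v times the measure of the small ball; this is the source of the factor k^(q/p).\<close>
    have N: "0 \<le> N" "(C' powr (1 / p) * N) powr p = C' * k powr q * v"
      using v(1) assms(3) C'(1) kr(1) by (auto simp: N_def powr_mult powr_powr)
    \<comment> \<open>The slack \<open>e\<close> supplies the strict inequality required by the
      compact approximation, and keeps \<open>S\<close> positive even when \<open>N\<close> is
      0.\<close>
    have approx: "?osc \<le> 2 * (ennreal (4 * L / k) * ?F + ennreal (2 * (A * (C' powr (1 / p) * N + e))))"
      if e: "0 < e" for e
    proof -
      define S where "S = C' powr (1 / p) * N + e"
      have S: "0 < S"
        using N(1) e C'(1) by (simp add: S_def add_nonneg_pos)
      \<comment> \<open>With this scale the p-th power of \<open>w\<close> is S^p times the measure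
        of the ball, so averaging \<open>T h\<close> over the ball yields a multiple of
        \<open>S\<close> free of the measure.\<close>
      define w where "w = S * measure \<mu> ?B powr (1 / p)"
      have w: "0 < w" "w powr p = S powr p * measure \<mu> ?B"
        using S mB assms(3) by (auto simp: w_def powr_mult powr_powr)
      have "(LINT y:qb xb (k * r)|\<mu>. norm (f y) powr p) \<le> v * (C' * k powr q * measure \<mu> ?B)"
        unfolding v(2) using v(1) C'(2)[OF _ r xb, of k] kr(1) by (intro mult_left_mono) auto
      also have "\<dots> = (C' powr (1 / p) * N) powr p * measure \<mu> ?B"
        unfolding N(2) by simp
      also have "\<dots> < S powr p * measure \<mu> ?B"
        using mB(1) N(1) C'(1) assms(3) e
        by (intro mult_strict_right_mono powr_less_mono2) (auto simp: S_def)
      finally have "(LINT y:qb xb (k * r)|\<mu>. norm (f y) powr p) < w powr p"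
        by (simp add: w(2))
      from compact_support_approximation[OF assms(2) xb kr(2) f assms(3) this]
      obtain E where E: "compactin \<tau> E" "E \<inter> qb xb (k * r) = {}"
          "(\<integral>y. norm (f y - indicator E y *\<^sub>R f y) powr p \<partial>\<mu>) < w powr p" by blast
      let ?g = "\<lambda>y. indicator E y *\<^sub>R f y"
      define h where "h = (\<lambda>y. f y - ?g y)"
      have g: "?g \<in> Lp p \<mu>"
        using f compactin_sets[OF E(1)] assms(3) by (rule Lp_indicator)
      have h: "h \<in> Lp p \<mu>"
      proof -
        have "space \<mu> - E \<in> sets \<mu>"
          using compactin_sets[OF E(1)] by blast
        from Lp_indicator[OF f this assms(3)]
        have "(\<lambda>y. indicator (space \<mu> - E) y *\<^sub>R f y) \<in> Lp p \<mu>" .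
        \<comment> \<open>The two functions agree only on \<open>space \<mu>\<close>, so
          integrability is transferred by congruence there.\<close>
        moreover have "integrable \<mu> (\<lambda>y. norm (indicator (space \<mu> - E) y *\<^sub>R f y) powr p)
            \<longleftrightarrow> integrable \<mu> (\<lambda>y. norm (h y) powr p)"
          by (intro Bochner_Integration.integrable_cong) (auto simp: h_def indicator_def)
        moreover have "h \<in> borel_measurable \<mu>"
          unfolding h_def using f g by (intro borel_measurable_diff) (simp_all add: Lp_def)
        ultimately show ?thesis
          by (simp add: Lp_def)
      qed
      have "AE x in \<mu>. T (\<lambda>y. 1 * ?g y + 1 * h y) x = 1 * T ?g x + 1 * T h x"
        using assms(4)[unfolded bounded_linear_Lp_def, THEN conjunct2, THEN conjunct1] g h
        by (elim ballE[of _ _ ?g] ballE[of _ _ h] allE[of _ 1]) auto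
      then have split: "AE x in \<mu>. T f x = T ?g x + T h x"
        by (simp add: h_def)
      obtain b where b: "AE x in \<mu>. x \<in> ?B \<longrightarrow> ennreal (norm (T ?g x - b)) \<le> ennreal (4 * L / k) * ?F"
        using far_part_oscillation[OF assms(5,3) f xb r assms(6) k x0 E(1,2) L(1) L(2)[OF xb]] by blast
      have Tm: "T f \<in> borel_measurable \<mu>" "T h \<in> borel_measurable \<mu>"
        using TLp f h by (auto simp: Lp_def)
      have "(\<integral>\<^sup>+x. ennreal (norm (T h x) powr p) \<partial>\<mu>) \<le> ennreal ((A * w) powr p)"
        using bound[OF h w(1)] E(3) by (simp add: h_def)
      also have "\<dots> = ennreal ((A * S) powr p) * emeasure \<mu> ?B"
        using A(1) S w mB(1) by (simp add: powr_mult emeasure_qball_eq[OF xb r] ennreal_mult[symmetric])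
      finally have near: "nn_avg \<mu> ?B (\<lambda>x. norm (T h x)) \<le> ennreal (2 * (A * S))"
        using Tm(2) B A(1) S assms(3) by (intro nn_avg_le_of_powr_bound) auto
      have "?osc \<le> 2 * nn_avg \<mu> ?B (\<lambda>x. norm (T f x - b))"
        using Lp_set_integrable[OF TLp[OF f] B(1,3) assms(3)] Tm(1) B by (intro nn_avg_oscillation_le)
      also have "\<dots> \<le> 2 * (ennreal (4 * L / k) * ?F + nn_avg \<mu> ?B (\<lambda>x. norm (T h x)))"
      proof (intro mult_left_mono nn_avg_triangle Tm B)
        show "AE x in \<mu>. x \<in> ?B \<longrightarrow>
            ennreal (norm (T f x - b)) \<le> ennreal (4 * L / k) * ?F + ennreal (norm (T h x))"
          using split b
        proof eventually_elim
          case (elim x)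
          have "norm (T f x - b) \<le> norm (T ?g x - b) + norm (T h x)"
            using norm_triangle_ineq[of "T ?g x - b" "T h x"] elim(1) by (simp add: algebra_simps)
          then have "ennreal (norm (T f x - b)) \<le> ennreal (norm (T ?g x - b)) + ennreal (norm (T h x))"
            by (simp add: ennreal_plus[symmetric] del: ennreal_plus)
          then show ?case
            using elim(2) by (meson add_right_mono order_trans)
        qed
      qed simp
      also have "\<dots> \<le> 2 * (ennreal (4 * L / k) * ?F + ennreal (2 * (A * S)))"
        using near by (intro mult_left_mono add_left_mono) auto
      finally show ?thesis
        by (simp add: S_def)
    qed
    have "?osc \<le> ennreal c * (ennreal (1 / k) * ?F + ennreal N)"
    proof (rule ennreal_le_epsilon)
      fix e :: real assume e: "0 < e"
      have two: "2 * ennreal t = ennreal (2 * t)" for t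
        by (simp add: ennreal_mult')
      \<comment> \<open>The slack is multiplied by 2, 2 and \<open>A\<close> in the estimate, so
        e/(4A) turns into exactly \<open>e\<close>.\<close>
      have "?osc \<le> 2 * (ennreal (4 * L / k) * ?F + ennreal (2 * (A * (C' powr (1 / p) * N + e / (4 * A)))))"
        using approx[of "e / (4 * A)"] e A(1) by simp
      also have "\<dots> = ennreal (8 * L / k) * ?F + ennreal (4 * A * C' powr (1 / p) * N + e)"
        using A(1) by (simp add: distrib_left mult.assoc[symmetric] two del: ennreal_plus)
      also have "\<dots> = ennreal (8 * L) * (ennreal (1 / k) * ?F) + ennreal (4 * A * C' powr (1 / p)) * ennreal N
          + ennreal e"
        using A(1) L(1) kr(1) N(1) e C'(1)
        by (simp add: mult.assoc[symmetric] ennreal_mult[symmetric] add.assoc)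
      also have "\<dots> \<le> ennreal c * (ennreal (1 / k) * ?F) + ennreal c * ennreal N + ennreal e"
        using A(1) L(1) by (intro add_mono mult_right_mono ennreal_leI) (auto simp: c_def)
      finally show "?osc \<le> ennreal c * (ennreal (1 / k) * ?F + ennreal N) + ennreal e"
        by (simp add: distrib_left)
    qed
    then show "?osc \<le> ennreal c * (ennreal (1 / k) * ?F
        + ennreal (k powr (q / p) * avg \<mu> (qb xb (k * r)) (\<lambda>x. norm (f x) powr p) powr (1 / p)))"
      by (simp add: N_def v_def)
  qed
qed

end
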